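(* Let $\mathbb{S}$ denote the set of symmetric matrix polynomials in $\mathbb{P}_m(\mathbb{C}^{n\times n})$ and let $P\in\mathbb{S}$ be regular. Let $(\lambda,x)\in\mathbb{C}\times\mathbb{C}^n$ be such that $x^Hx=1$. Set $r:=-P(\lambda)x$, $P_x:=I-xx^H$ and $\Lambda_m:=[1,\lambda,\ldots,\lambda^m]^T$. Then $$\eta_F^{\mathbb{S}}(\lambda,x,P)=\frac{\sqrt{2\|r\|_2^2-|x^Tr|^2}}{\|\Lambda_m\|_2}\le\sqrt2\,\eta(\lambda,x,P)\quad\text{and}\quad \eta_2^{\mathbb{S}}(\lambda,x,P)=\eta(\lambda,x,P).$$ (i) For $j=0,\ldots,m$ set $\Delta A_j:=\frac{\overline{\lambda^j}}{\|\Lambda_m\|_2^2}\left[\overline{x}r^T+rx^H-(r^Tx)\overline{x}x^H\right]$ and $\Delta P(z):=\sum_{j=0}^m z^j\Delta A_j$. Then $\Delta P$ is the unique polynomial such that $\Delta P\in\mathbb{S}$, $P(\lambda)x+\Delta P(\lambda)x=0$ and $|||\Delta P|||_F=\eta_F^{\mathbb{S}}(\lambda,x,P)$. (ii) For $j=0,\ldots,m$ set $$\Delta A_j:=\frac{\overline{\lambda^j}}{\|\Lambda_m\|_2^2}\left[\overline{x}r^T+rx^H-(r^Tx)\overline{x}x^H\right]-\frac{\overline{\lambda^j}\;\overline{x^Tr}\;P_x^Trr^TP_x}{\|\Lambda_m\|_2^2\,(\|r\|_2^2-|x^Tr|^2)},$$ where the last term is taken to be $0$ if $|x^Tr|=\|r\|_2$,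 and $\Delta P(z):=\sum_{j=0}^m z^j\Delta A_j$. Then $\Delta P\in\mathbb{S}$, $P(\lambda)x+\Delta P(\lambda)x=0$ and $|||\Delta P|||_2=\eta_2^{\mathbb{S}}(\lambda,x,P)$.
   Context: $m,n\ge1$ are integers. $\mathbb{P}_m(\mathbb{C}^{n\times n})$ is the vector space of matrix polynomials $P(z)=\sum_{j=0}^m z^jA_j$ with $A_j\in\mathbb{C}^{n\times n}$ (degree at most $m$). $P$ is regular if $\det P(z)\ne0$ for some $z\in\mathbb{C}$. $P$ is symmetric if $P(z)^T=P(z)$ for all $z$, i.e. all $A_j^T=A_j$. Bars denote entrywise complex conjugation. For $M\in\{2,F\}$, $|||P|||_M:=\left(\sum_{j=0}^m\|A_j\|_M^2\right)^{1/2}$, where $\|\cdot\|_F$ is the Frobenius norm and $\|\cdot\|_2$ the spectral norm. For $P$ regular, $\lambda\in\mathbb{C}$ and $x\in\mathbb{C}^n$ with $x^Hx=1$, the unstructured backward error is $\eta(\lambda,x,P):=\inf\{|||\Delta P|||_M:\Delta P\in\mathbb{P}_m(\mathbb{C}^{n\times n}),\ P(\lambda)x+\Delta P(\lambda)x=0\}$, which equals $\|P(\lambda)x\|_2/\|\Lambda_m\|_2$ for both $M=2$ and $M=F$. For $P\in\mathbb{S}$ the structured backward error is $\eta_M^{\mathbb{S}}(\lambda,x,P):=\inf\{|||\Delta P|||_M:\Delta P\in\mathbb{S},\ P(\lambda)x+\Delta P(\lambda)x=0\}$. *)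

theory Defs
  imports "HOL-Analysis.Analysis" "HOL-Computational_Algebra.Polynomial"
begin

definition mat_scale :: "complex \<Rightarrow> complex^'n^'n \<Rightarrow> complex^'n^'n" (infixr \<open>*m\<close> 75) where
  "c *m A = map_matrix ((*) c) A"

definition vec_cnj :: "complex^'n \<Rightarrow> complex^'n" where
  "vec_cnj v = (\<chi> i. cnj (v $ i))"

text \<open>\<open>outer v w\<close> is the matrix \<open>v w\<^sup>T\<close> (no conjugation), so that \<open>v w\<^sup>H\<close> is
  \<open>outer v (vec_cnj w)\<close>. Likewise \<open>v\<^sup>T w\<close> is \<open>scalar_product v w\<close>.\<close>

definition outer :: "complex^'n \<Rightarrow> complex^'n \<Rightarrow> complex^'n^'n" where
  "outer v w = (\<chi> i j. v $ i * w $ j)"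

text \<open>A matrix polynomial is represented by the library polynomial whose coefficients are its
  coefficient matrices. The library's evaluation \<open>poly\<close> and its product would use the entrywise
  product of matrices, so evaluation at a scalar is defined separately.\<close>

type_synonym 'n matpoly = "(complex^'n^'n) poly"

definition mpeval :: "('n::finite) matpoly \<Rightarrow> complex \<Rightarrow> complex^'n^'n" where
  "mpeval P z = (\<Sum>j\<le>degree P. (z ^ j) *m coeff P j)"

definition mpoly_of :: "nat \<Rightarrow> (nat \<Rightarrow> complex^'n^'n) \<Rightarrow> ('n::finite) matpoly" where
  "mpoly_of m A = (\<Sum>j\<le>m. monom (A j) j)"

definition matpolys :: "nat \<Rightarrow> ('n::finite) matpoly set" where
  "matpolys m = {P. degree P \<le> m}"

definition symmetric_matpolys :: "nat \<Rightarrow> ('n::finite) matpoly set" where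
  "symmetric_matpolys m = {P \<in> matpolys m. \<forall>z. transpose (mpeval P z) = mpeval P z}"

definition regular_matpoly :: "('n::finite) matpoly \<Rightarrow> bool" where
  "regular_matpoly P \<longleftrightarrow> (\<exists>z. det (mpeval P z) \<noteq> 0)"

datatype norm_kind = Spectral | Frobenius

text \<open>The library norm of \<open>complex^'n^'n\<close> is the Euclidean norm of the family of all entries.\<close>

fun mat_norm :: "norm_kind \<Rightarrow> complex^'n^'n \<Rightarrow> real" where
  "mat_norm Spectral A = onorm (\<lambda>v. A *v v)"
| "mat_norm Frobenius A = norm A"

definition mp_norm :: "norm_kind \<Rightarrow> nat \<Rightarrow> ('n::finite) matpoly \<Rightarrow> real" where
  "mp_norm M m P = sqrt (\<Sum>j\<le>m. (mat_norm M (coeff P j))\<^sup>2)"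

text \<open>Backward error of \<open>(l, x)\<close> with perturbations restricted to \<open>S\<close>. The infimum is over a
  set of nonnegative reals, which contains the norm of \<open>-P\<close> if \<open>-P \<in> S\<close>, so it is a true
  infimum in both uses below.\<close>

definition backward_error_on ::
    "('n::finite) matpoly set \<Rightarrow> norm_kind \<Rightarrow> nat \<Rightarrow> complex \<Rightarrow> complex^'n \<Rightarrow> 'n matpoly \<Rightarrow> real" where
  "backward_error_on S M m l x P =
     Inf {mp_norm M m D | D. D \<in> S \<and> mpeval P l *v x + mpeval D l *v x = 0}"

definition backward_error ::
    "norm_kind \<Rightarrow> nat \<Rightarrow> complex \<Rightarrow> complex^('n::finite) \<Rightarrow> 'n matpoly \<Rightarrow> real" where
  "backward_error M m l x P = backward_error_on (matpolys m) M m l x P"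

definition sym_backward_error ::
    "norm_kind \<Rightarrow> nat \<Rightarrow> complex \<Rightarrow> complex^('n::finite) \<Rightarrow> 'n matpoly \<Rightarrow> real" where
  "sym_backward_error M m l x P = backward_error_on (symmetric_matpolys m) M m l x P"

definition Lambda_norm :: "nat \<Rightarrow> complex \<Rightarrow> real" where
  "Lambda_norm m l = sqrt (\<Sum>j\<le>m. (cmod (l ^ j))\<^sup>2)"

end

theory Submission
  imports Defs
begin

text \<open>Minimising over the coefficients with \<open>E = \<Delta>P(\<lambda>)\<close> fixed amounts, by Cauchy-Schwarz, to
  taking them proportional to \<open>cnj (\<lambda>^j)\<close>, which gives norm \<open>\<parallel>E\<parallel> / \<parallel>\<Lambda>\<^sub>m\<parallel>\<close>; so everything reduces to
  symmetric matrices \<open>E\<close> with \<open>E x = r\<close>. The matrix in (i) is orthogonal, for the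
  Frobenius inner product, to every symmetric \<open>H\<close> with \<open>H x = 0\<close>, so by Pythagoras it is the
  unique minimiser. For the spectral norm \<open>\<parallel>E\<parallel> \<ge> \<parallel>r\<parallel>\<close> is clear; the correction term in (ii)
  makes \<open>E\<close> act, in the orthonormal pair given by \<open>cnj x\<close> and the normalised \<open>P\<^sub>x\<^sup>T r\<close>, as a
  \<open>2 \<times> 2\<close> multiple of a unitary matrix of norm exactly \<open>\<parallel>r\<parallel>\<close>.\<close>

section \<open>Entrywise algebra of scaling, outer products and the bilinear pairing\<close>

lemma mat_scale_nth [simp]: "(c *m A) $ i $ j = c * A $ i $ j"
  by (simp add: mat_scale_def map_matrix_def)

lemma outer_nth [simp]: "outer v w $ i $ j = v $ i * w $ j"
  by (simp add: outer_def)

lemma vec_cnj_nth [simp]: "vec_cnj v $ i = cnj (v $ i)"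
  by (simp add: vec_cnj_def)

lemma vec_cnj_vec_cnj [simp]: "vec_cnj (vec_cnj v) = v"
  by (simp add: vec_eq_iff)

lemma mat_scale_zero [simp]: "c *m 0 = 0"
  by (simp add: vec_eq_iff)

lemma mat_scale_diff: "c *m (A - B) = c *m A - c *m B"
  by (simp add: vec_eq_iff algebra_simps)

lemma mat_scale_mat_scale: "c *m (d *m A) = (c * d) *m A"
  by (simp add: vec_eq_iff)

lemma mat_scale_one [simp]: "1 *m A = A"
  by (simp add: vec_eq_iff)

lemma transpose_mat_scale: "transpose (c *m A) = c *m transpose A"
  by (simp add: vec_eq_iff transpose_def)

lemma transpose_outer [simp]: "transpose (outer v w) = outer w v"
  by (simp add: vec_eq_iff transpose_def)

lemma transpose_add: "transpose (A + B) = transpose A + transpose (B :: complex^'n^'m)"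
  by (simp add: vec_eq_iff transpose_def)

lemma transpose_zero [simp]: "transpose (0 :: complex^'n^'m) = 0"
  by (simp add: vec_eq_iff transpose_def)

lemma transpose_diff: "transpose (A - B) = transpose A - transpose (B :: complex^'n^'m)"
  by (simp add: vec_eq_iff transpose_def)

lemma transpose_sum: "transpose (\<Sum>i\<in>I. A i) = (\<Sum>i\<in>I. transpose (A i :: complex^'n^'m))"
  by (simp add: vec_eq_iff transpose_def)

lemma mat_scale_mult_vec: "(c *m A) *v v = c *s (A *v v)"
  by (simp add: vec_eq_iff matrix_vector_mult_def sum_distrib_left mult.assoc)

lemma outer_mult_vec: "outer u w *v v = scalar_product w v *s u"
  by (simp add: vec_eq_iff matrix_vector_mult_def scalar_product_def sum_distrib_left mult_ac)

lemma sum_mult_vec: "(\<Sum>i\<in>I. A i) *v v = (\<Sum>i\<in>I. (A i :: complex^'n^'m) *v v)"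
  by (induction I rule: infinite_finite_induct) (auto simp: matrix_vector_mult_add_rdistrib)

text \<open>Serves to read \<open>transpose Px ** outer r r ** Px\<close> in (ii) as the rank-one
  matrix \<open>outer w w\<close> with \<open>w = transpose Px *v r\<close>.\<close>

lemma mult_outer_mult: "A ** outer u v ** B = outer (A *v u) (transpose B *v v)"
  by (simp add: vec_eq_iff matrix_matrix_mult_def matrix_vector_mult_def transpose_def
      sum_distrib_left sum_distrib_right sum_product mult_ac)

lemma scalar_product_commute: "scalar_product v w = scalar_product w (v :: complex^'n)"
  by (simp add: scalar_product_def mult.commute)

lemma scalar_product_linear_right [simp]:
  "scalar_product (u :: complex^'n) (v + w) = scalar_product u v + scalar_product u w"
  "scalar_product u (v - w) = scalar_product u v - scalar_product u w"
  "scalar_product u (c *s v) = c * scalar_product u v"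
  "scalar_product u 0 = 0"
  by (simp_all add: scalar_product_def algebra_simps sum.distrib sum_subtractf sum_distrib_left)

lemma scalar_product_linear_left [simp]:
  "scalar_product (v + w) (u :: complex^'n) = scalar_product v u + scalar_product w u"
  "scalar_product (v - w) u = scalar_product v u - scalar_product w u"
  "scalar_product (c *s v) u = c * scalar_product v u"
  "scalar_product 0 u = 0"
  by (simp_all add: scalar_product_def algebra_simps sum.distrib sum_subtractf sum_distrib_left)

lemma vec_cnj_linear [simp]:
  "vec_cnj (v + w) = vec_cnj v + vec_cnj w"
  "vec_cnj (v - w) = vec_cnj v - vec_cnj w"
  "vec_cnj (c *s v) = cnj c *s vec_cnj v"
  by (simp_all add: vec_eq_iff)

lemma cnj_scalar_product: "cnj (scalar_product v w) = scalar_product (vec_cnj v) (vec_cnj w)"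
  by (simp add: scalar_product_def)

section \<open>Euclidean norms of vectors and matrices\<close>

lemma of_real_norm_square_vec:
  "complex_of_real ((norm v)\<^sup>2) = scalar_product (vec_cnj v) (v :: complex^'n)"
proof -
  have "(norm v)\<^sup>2 = (\<Sum>i\<in>UNIV. (norm (v $ i))\<^sup>2)"
    by (simp add: norm_vec_def L2_set_def sum_nonneg)
  then show ?thesis
    by (simp only: of_real_sum complex_norm_square scalar_product_def vec_cnj_nth mult.commute)
qed

lemma norm_eq_1_vec:
  assumes "scalar_product (vec_cnj v) v = 1"
  shows "norm (v :: complex^'n) = 1"
proof -
  have "complex_of_real ((norm v)\<^sup>2) = complex_of_real 1"
    using assms unfolding of_real_norm_square_vec by simp
  then have "(norm v)\<^sup>2 = 1"
    by (simp only: of_real_eq_iff)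
  then show ?thesis
    using norm_ge_zero[of v] by (auto simp: power2_eq_1_iff)
qed

lemma norm_scalar_mult_vec: "norm (c *s v) = cmod c * norm (v :: complex^'n)"
  by (simp add: norm_vec_def norm_mult L2_set_right_distrib)

lemma norm_vec_cnj [simp]: "norm (vec_cnj v) = norm v"
  by (simp add: norm_vec_def)

lemma norm_mat_scale: "norm (c *m A) = cmod c * norm A"
  by (simp add: norm_vec_def norm_mult L2_set_right_distrib)

lemma norm_outer: "norm (outer u v) = norm u * norm v"
proof -
  have "outer u v $ i = u $ i *s v" for i
    by (simp add: vec_eq_iff)
  then show ?thesis
    by (simp add: norm_vec_def[of "outer u v"] norm_scalar_mult_vec norm_vec_def[of u]
        L2_set_left_distrib)
qed

text \<open>Cauchy-Schwarz in each row, then summation of the squares over the rows. Hence the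
  Frobenius norm dominates the spectral norm.\<close>

lemma norm_mult_vec_le: "norm ((A :: complex^'n^'n) *v v) \<le> norm A * norm v"
proof -
  have "norm ((A *v v) $ i) \<le> norm (A $ i) * norm v" for i
  proof -
    have "norm ((A *v v) $ i) \<le> (\<Sum>j\<in>UNIV. \<bar>norm (A $ i $ j)\<bar> * \<bar>norm (v $ j)\<bar>)"
      unfolding matrix_vector_mult_def
      by (simp add: norm_mult[symmetric]) (rule norm_sum)
    also have "\<dots> \<le> norm (A $ i) * norm v"
      unfolding norm_vec_def by (rule L2_set_mult_ineq)
    finally show ?thesis .
  qed
  then have "norm (A *v v) \<le> L2_set (\<lambda>i. norm (A $ i) * norm v) UNIV"
    unfolding norm_vec_def[of "A *v v"] by (intro L2_set_mono) auto
  then show ?thesis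
    by (simp add: norm_vec_def[of A] L2_set_left_distrib)
qed

section \<open>Common properties of the spectral and the Frobenius norm\<close>

lemma mat_norm_nonneg: "0 \<le> mat_norm M A"
  by (cases M) (simp_all add: onorm_pos_le matrix_vector_mul_bounded_linear)

lemma mat_norm_mult_vec: "norm (A *v v) \<le> mat_norm M A * norm v"
  by (cases M) (simp_all add: onorm matrix_vector_mul_bounded_linear norm_mult_vec_le)

lemma mat_norm_Spectral_le: "(\<And>v. norm (A *v v) \<le> b * norm v) \<Longrightarrow> mat_norm Spectral A \<le> b"
  by (simp add: onorm_le)

lemma mat_norm_le_norm: "mat_norm M A \<le> norm A"
  by (cases M) (simp_all add: onorm_le norm_mult_vec_le)

lemma mat_norm_scale: "mat_norm M (c *m A) = cmod c * mat_norm M A"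
proof (cases M)
  case Spectral
  have le: "mat_norm Spectral (c *m A) \<le> cmod c * mat_norm Spectral A" for c and A :: "complex^'a^'a"
    using mat_norm_mult_vec[of A _ Spectral]
    by (intro mat_norm_Spectral_le) (simp add: mat_scale_mult_vec norm_scalar_mult_vec
        mult.assoc mult_left_mono del: mat_norm.simps)
  show ?thesis
  proof (cases "c = 0")
    case True
    then show ?thesis using le[of 0 A] mat_norm_nonneg[of Spectral "0 *m A"] Spectral
      by (simp del: mat_norm.simps)
  next
    case False
    \<comment> \<open>The reverse inequality comes from \<open>le\<close> applied to
      \<open>inverse c\<close> and \<open>c *m A\<close>.\<close>
    have "mat_norm Spectral A \<le> cmod (inverse c) * mat_norm Spectral (c *m A)"
      using le[of "inverse c" "c *m A"] False
      by (simp add: mat_scale_mat_scale mat_scale_one del: mat_norm.simps)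
    then have "cmod c * mat_norm Spectral A \<le> mat_norm Spectral (c *m A)"
      using False by (simp add: norm_inverse pos_le_divide_eq mult.commute inverse_eq_divide
          norm_divide del: mat_norm.simps)
    with le[of c A] Spectral show ?thesis
      by (simp del: mat_norm.simps)
  qed
qed (simp add: norm_mat_scale)

section \<open>Matrix polynomials with a prescribed value at one point\<close>

lemma mpeval_le:
  assumes "D \<in> matpolys m"
  shows "mpeval D z = (\<Sum>j\<le>m. (z ^ j) *m coeff D j)"
  unfolding mpeval_def using assms
  by (intro sum.mono_neutral_left) (auto simp: matpolys_def coeff_eq_0)

lemma coeff_mpoly_of: "coeff (mpoly_of m A) j = (if j \<le> m then A j else 0)"
  by (simp add: mpoly_of_def coeff_sum coeff_monom)

lemma mpoly_of_in_matpolys: "mpoly_of m A \<in> matpolys m"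
  by (auto simp: matpolys_def coeff_mpoly_of intro: degree_le)

lemma mpeval_mpoly_of: "mpeval (mpoly_of m A) z = (\<Sum>j\<le>m. (z ^ j) *m A j)"
  by (simp add: mpeval_le[OF mpoly_of_in_matpolys] coeff_mpoly_of)

lemma mp_norm_mpoly_of: "mp_norm M m (mpoly_of m A) = sqrt (\<Sum>j\<le>m. (mat_norm M (A j))\<^sup>2)"
  by (simp add: mp_norm_def coeff_mpoly_of)

lemma Lambda_norm_square: "(Lambda_norm m l)\<^sup>2 = (\<Sum>j\<le>m. (cmod (l ^ j))\<^sup>2)"
  by (simp add: Lambda_norm_def sum_nonneg)

lemma Lambda_norm_pos: "0 < Lambda_norm m l"
proof -
  \<comment> \<open>The index 0 contributes 1 even for \<open>l = 0\<close>, as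
    \<open>0 ^ 0 = 1\<close>.\<close>
  have "(cmod (l ^ 0))\<^sup>2 \<le> (\<Sum>j\<le>m. (cmod (l ^ j))\<^sup>2)"
    by (rule member_le_sum) auto
  then show ?thesis
    unfolding Lambda_norm_def by (intro real_sqrt_gt_zero) auto
qed

text \<open>The scalar weights form the Moore-Penrose inverse of the row
  \<open>[1, l, ..., l ^ m]\<close>; their products with \<open>l ^ j\<close> sum to 1.\<close>

definition spread :: "nat \<Rightarrow> complex \<Rightarrow> complex^'n^'n \<Rightarrow> nat \<Rightarrow> complex^'n^'n" where
  "spread m l E j = (cnj (l ^ j) / complex_of_real ((Lambda_norm m l)\<^sup>2)) *m E"

lemma mpeval_spread: "mpeval (mpoly_of m (spread m l E)) l = E"
proof -
  let ?q = "complex_of_real ((Lambda_norm m l)\<^sup>2)"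
  have q: "?q = (\<Sum>j\<le>m. l ^ j * cnj (l ^ j))"
    by (simp only: Lambda_norm_square of_real_sum complex_norm_square)
  have "?q \<noteq> 0"
    using Lambda_norm_pos[of m l] by simp
  then have "(\<Sum>j\<le>m. l ^ j * (cnj (l ^ j) / ?q * y)) = y" for y
    using q by (simp only: times_divide_eq_right times_divide_eq_left mult.assoc[symmetric]
        sum_divide_distrib[symmetric] sum_distrib_right[symmetric]) simp
  then show ?thesis
    unfolding mpeval_mpoly_of spread_def by (simp only: vec_eq_iff sum_component mat_scale_nth) simp
qed

text \<open>The squared moduli of the weights sum to \<open>1 / (Lambda_norm m l)\<^sup>2\<close>.
  Only homogeneity of the norm enters, so both norms are covered at once.\<close>

lemma mp_norm_spread:
  "mp_norm M m (mpoly_of m (spread m l E)) = mat_norm M E / Lambda_norm m l"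
proof -
  let ?L = "Lambda_norm m l"
  have "(\<Sum>j\<le>m. (mat_norm M (spread m l E j))\<^sup>2)
      = (\<Sum>j\<le>m. (cmod (l ^ j))\<^sup>2) * ((mat_norm M E)\<^sup>2 / (?L\<^sup>2)\<^sup>2)"
    unfolding sum_distrib_right
    by (intro sum.cong) (simp_all add: spread_def mat_norm_scale norm_divide power_mult_distrib
        power_divide norm_power del: mat_norm.simps)
  also have "\<dots> = (mat_norm M E / ?L)\<^sup>2"
    using Lambda_norm_pos[of m l]
    unfolding Lambda_norm_square[symmetric] by (simp add: power_divide power2_eq_square)
  finally show ?thesis
    using Lambda_norm_pos[of m l] mat_norm_nonneg[of M E]
    by (simp add: mp_norm_mpoly_of del: mat_norm.simps)
qed

lemma spread_symmetric:
  "transpose E = E \<Longrightarrow> mpoly_of m (spread m l E) \<in> symmetric_matpolys m"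
  by (simp add: symmetric_matpolys_def mpoly_of_in_matpolys mpeval_mpoly_of spread_def
      transpose_sum transpose_mat_scale)

text \<open>Triangle inequality over the coefficients, then Cauchy-Schwarz between the
  \<open>cmod (l ^ j)\<close> and the coefficient norms. This bound is attained in the unstructured
  problems and in the symmetric spectral one.\<close>

lemma mp_norm_lower_bound:
  assumes "D \<in> matpolys m" "norm x = 1"
  shows "norm (mpeval D l *v x) / Lambda_norm m l \<le> mp_norm M m D"
proof -
  have "norm (mpeval D l *v x) \<le> (\<Sum>j\<le>m. norm (((l ^ j) *m coeff D j) *v x))"
    unfolding mpeval_le[OF assms(1)] sum_mult_vec by (rule norm_sum)
  also have "\<dots> \<le> (\<Sum>j\<le>m. \<bar>cmod (l ^ j)\<bar> * \<bar>mat_norm M (coeff D j)\<bar>)"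
    using mat_norm_mult_vec[of _ x M] assms(2) mat_norm_nonneg[of M]
    by (intro sum_mono) (simp add: mat_scale_mult_vec norm_scalar_mult_vec mult_left_mono
        abs_of_nonneg[OF mat_norm_nonneg])
  also have "\<dots> \<le> Lambda_norm m l * mp_norm M m D"
    using L2_set_mult_ineq unfolding Lambda_norm_def mp_norm_def L2_set_def .
  finally show ?thesis
    using Lambda_norm_pos[of m l] by (simp add: divide_le_eq mult.commute)
qed

text \<open>Every infimum here is a minimum, so a feasible witness and a matching lower bound
  determine it.\<close>

lemma backward_error_on_eqI:
  assumes "D \<in> S" "mpeval P l *v x + mpeval D l *v x = 0" "mp_norm M m D = b"
    and "\<And>D. D \<in> S \<Longrightarrow> mpeval P l *v x + mpeval D l *v x = 0 \<Longrightarrow> b \<le> mp_norm M m D"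
  shows "backward_error_on S M m l x P = b"
  unfolding backward_error_on_def
  by (rule cInf_eq_minimum) (use assms in blast)+

section \<open>Frobenius geometry of the symmetric matrices sending \<open>x\<close> to
  \<open>r\<close>\<close>

lemma inner_mat_scale_right: "inner A (c *m B) = inner (cnj c *m A) B"
  by (simp add: inner_vec_def inner_complex_def algebra_simps)

text \<open>The library \<open>inner\<close> is the real part of the Hermitian Frobenius product;
  against a rank-one matrix it becomes a bilinear form in \<open>A\<close>.\<close>

lemma inner_outer: "inner A (outer u v) = Re (scalar_product (vec_cnj u) (A *v vec_cnj v))"
  by (simp add: inner_vec_def inner_complex_def scalar_product_def matrix_vector_mult_def
      sum_distrib_left algebra_simps)

lemma scalar_product_mult_vec:
  "scalar_product u (A *v v) = scalar_product (transpose A *v u) (v :: complex^'n)"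
  unfolding scalar_product_def matrix_vector_mult_def transpose_def
  by (simp add: sum_distrib_left sum_distrib_right mult_ac) (rule sum.swap)

text \<open>The bracket in (i). The term \<open>outer r (vec_cnj x)\<close> alone sends a unit
  vector \<open>x\<close> to \<open>r\<close>; its transpose restores symmetry, and the last term
  cancels what the transpose adds at \<open>x\<close>.\<close>

definition sym_map :: "complex^'n \<Rightarrow> complex^'n \<Rightarrow> complex^'n^'n" where
  "sym_map x r = outer (vec_cnj x) r + outer r (vec_cnj x)
     - scalar_product r x *m outer (vec_cnj x) (vec_cnj x)"

lemma transpose_sym_map: "transpose (sym_map x r) = sym_map x r"
  by (simp add: sym_map_def transpose_add transpose_diff transpose_mat_scale add.commute)

lemma sym_map_mult_vec:
  "sym_map x r *v v = scalar_product r v *s vec_cnj x + scalar_product (vec_cnj x) v *s r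
     - (scalar_product r x * scalar_product (vec_cnj x) v) *s vec_cnj x"
  by (simp add: sym_map_def matrix_vector_mult_add_rdistrib matrix_vector_mult_diff_rdistrib
      mat_scale_mult_vec outer_mult_vec)

lemma sym_map_mult_unit:
  assumes "scalar_product (vec_cnj x) x = 1"
  shows "sym_map x r *v x = r"
  using assms by (simp add: sym_map_mult_vec)

text \<open>Each rank-one term of \<open>sym_map\<close> has a factor \<open>vec_cnj x\<close>, so
  \<open>inner_outer\<close> produces \<open>H *v x\<close>, directly or after moving
  \<open>H\<close> across the pairing by symmetry.\<close>

lemma inner_sym_map_eq_0:
  assumes "transpose H = H" "H *v x = 0"
  shows "inner H (sym_map x r) = 0"
  using assms unfolding sym_map_def
  by (simp add: inner_diff_right inner_add_right inner_mat_scale_right inner_outer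
      scalar_product_mult_vec mat_scale_mult_vec transpose_mat_scale)

lemma norm_sym_map_square:
  assumes x: "scalar_product (vec_cnj x) x = 1"
  shows "(norm (sym_map x r))\<^sup>2 = 2 * (norm r)\<^sup>2 - (cmod (scalar_product x r))\<^sup>2"
proof -
  let ?E = "sym_map x r" and ?a = "vec_cnj x" and ?s = "scalar_product x r"
  have x': "scalar_product x ?a = 1"
    using x by (simp add: scalar_product_commute)
  have rr: "Re (scalar_product (vec_cnj r) r) = (norm r)\<^sup>2"
    by (simp flip: of_real_norm_square_vec)
  have ss: "Re (?s * cnj ?s) = (cmod ?s)\<^sup>2" "Re (cnj ?s * ?s) = (cmod ?s)\<^sup>2"
    by (simp_all only: mult.commute[of "cnj ?s"] complex_norm_square[symmetric] Re_complex_of_real)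
  have "inner ?E (outer r ?a) = (norm r)\<^sup>2"
    by (simp add: inner_outer sym_map_mult_unit[OF x] rr)
  moreover have "inner ?E (outer ?a r) = (norm r)\<^sup>2"
    by (simp add: inner_outer sym_map_mult_vec x' scalar_product_commute[of r] rr
        scalar_product_commute[of _ "vec_cnj r"])
  moreover have "inner ?E (scalar_product r x *m outer ?a ?a) = (cmod ?s)\<^sup>2"
    by (simp add: inner_mat_scale_right inner_outer mat_scale_mult_vec sym_map_mult_unit[OF x]
        scalar_product_commute[of r x] ss del: times_complex.sel)
  ultimately have "inner ?E ?E = 2 * (norm r)\<^sup>2 - (cmod ?s)\<^sup>2"
    \<comment> \<open>Only the second factor is expanded; its three terms were paired with
      \<open>?E\<close> above.\<close>
    by (subst (2) sym_map_def) (simp add: inner_diff_right inner_add_right)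
  then show ?thesis
    by (simp add: power2_norm_eq_inner)
qed

text \<open>Lifts a single orthogonality at the value \<open>mpeval D l\<close> to the coefficients.
  The remainder is the squared distance to the minimiser, which later gives both optimality and
  uniqueness.\<close>

lemma mp_norm_Frobenius_pythagoras:
  assumes D: "D \<in> matpolys m" and orth: "inner (mpeval D l - E) E = 0"
  shows "(mp_norm Frobenius m D)\<^sup>2 = (mp_norm Frobenius m (mpoly_of m (spread m l E)))\<^sup>2
    + (\<Sum>j\<le>m. (norm (coeff D j - spread m l E j))\<^sup>2)"
proof -
  let ?F = "spread m l E" and ?L = "Lambda_norm m l"
  have "inner (coeff D j - ?F j) (?F j) = inner ((l ^ j) *m coeff D j - (l ^ j) *m ?F j) E / ?L\<^sup>2" for j
  proof -
    \<comment> \<open>Moved to the other side of \<open>inner\<close>, the weight is conjugated back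
      to \<open>l ^ j\<close> up to a real factor, so summing over \<open>j\<close> evaluates at
      \<open>l\<close>.\<close>
    have "cnj (cnj (l ^ j) / complex_of_real (?L\<^sup>2)) = complex_of_real (1 / ?L\<^sup>2) * l ^ j"
      by simp
    moreover have "complex_of_real c *m A = c *\<^sub>R A" for c and A :: "complex^'a^'a"
      by (simp add: vec_eq_iff scaleR_conv_of_real[where ?'a = complex])
    ultimately have "inner A (?F j) = inner ((l ^ j) *m A) E / ?L\<^sup>2" for A
      by (simp only: spread_def[of m l E j] inner_mat_scale_right mat_scale_mat_scale[symmetric]
          inner_scaleR_left) simp
    then show ?thesis
      by (simp add: mat_scale_diff)
  qed
  then have "(\<Sum>j\<le>m. inner (coeff D j - ?F j) (?F j))
      = inner (\<Sum>j\<le>m. (l ^ j) *m coeff D j - (l ^ j) *m ?F j) E / ?L\<^sup>2"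
    by (simp add: inner_sum_left sum_divide_distrib)
  also have "\<dots> = inner (mpeval D l - mpeval (mpoly_of m ?F) l) E / ?L\<^sup>2"
    by (simp only: mpeval_le[OF D] mpeval_mpoly_of sum_subtractf)
  finally have 0: "(\<Sum>j\<le>m. inner (coeff D j - ?F j) (?F j)) = 0"
    by (simp only: mpeval_spread orth div_0)
  have "(norm (coeff D j))\<^sup>2 = (norm (?F j))\<^sup>2 + (norm (coeff D j - ?F j))\<^sup>2
      + 2 * inner (coeff D j - ?F j) (?F j)" for j
    by (simp add: power2_norm_eq_inner inner_diff_left inner_diff_right inner_commute)
  then have "(\<Sum>j\<le>m. (norm (coeff D j))\<^sup>2) = (\<Sum>j\<le>m. (norm (?F j))\<^sup>2)
      + (\<Sum>j\<le>m. (norm (coeff D j - ?F j))\<^sup>2)"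
    using 0 by (simp add: sum.distrib flip: sum_distrib_left)
  then show ?thesis
    by (simp add: mp_norm_def coeff_mpoly_of sum_nonneg)
qed

section \<open>Orthonormal pairs and the spectral norm of the corrected matrix\<close>

lemma norm_add_orthogonal:
  assumes "scalar_product (vec_cnj u) v = 0"
  shows "(norm (u + v))\<^sup>2 = (norm u)\<^sup>2 + (norm (v :: complex^'n))\<^sup>2"
proof -
  have "scalar_product u (vec_cnj v) = 0"
    using arg_cong[OF assms, of cnj] by (simp add: cnj_scalar_product)
  then have "complex_of_real ((norm (u + v))\<^sup>2) = complex_of_real ((norm u)\<^sup>2 + (norm v)\<^sup>2)"
    using assms unfolding of_real_add of_real_norm_square_vec
    by (simp add: scalar_product_commute[of "vec_cnj v" u])
  then show ?thesis
    by (simp only: of_real_eq_iff)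
qed

lemma bessel_two:
  fixes a b :: "complex^'n"
  assumes "norm a = 1" "norm b = 1" "scalar_product (vec_cnj a) b = 0"
  shows "(cmod (scalar_product (vec_cnj a) v))\<^sup>2 + (cmod (scalar_product (vec_cnj b) v))\<^sup>2 \<le> (norm v)\<^sup>2"
proof -
  let ?p = "scalar_product (vec_cnj a) v" and ?q = "scalar_product (vec_cnj b) v"
  \<comment> \<open>The component of \<open>v\<close> orthogonal to both \<open>a\<close> and
    \<open>b\<close>.\<close>
  define w where "w = v - ?p *s a - ?q *s b"
  have ab: "scalar_product (vec_cnj a) a = 1" "scalar_product (vec_cnj b) b = 1"
    using assms(1,2) by (simp_all flip: of_real_norm_square_vec)
  have ba: "scalar_product (vec_cnj b) a = 0"
    using arg_cong[OF assms(3), of cnj] by (simp add: cnj_scalar_product scalar_product_commute)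
  have aw: "scalar_product (vec_cnj a) w = 0" and bw: "scalar_product (vec_cnj b) w = 0"
    by (simp_all add: w_def ab ba assms(3))
  have "v = ?p *s a + (?q *s b + w)"
    by (simp add: w_def)
  then have "(norm v)\<^sup>2 = (norm (?p *s a + (?q *s b + w)))\<^sup>2"
    by simp
  also have "\<dots> = (norm (?p *s a))\<^sup>2 + ((norm (?q *s b))\<^sup>2 + (norm w)\<^sup>2)"
    by (simp add: norm_add_orthogonal aw bw assms(3))
  finally show ?thesis
    using assms(1,2) by (simp add: norm_scalar_mult_vec)
qed

text \<open>In the orthonormal pair \<open>a\<close>, \<open>b\<close> the matrix is the block
  \<open>((s, t), (t, - cnj s))\<close>, a multiple of a unitary matrix.\<close>

lemma mat_norm_Spectral_block_le:
  fixes a b :: "complex^'n"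
  assumes ab: "norm a = 1" "norm b = 1" "scalar_product (vec_cnj a) b = 0"
  shows "mat_norm Spectral (s *m outer a a + complex_of_real t *m (outer a b + outer b a)
      - cnj s *m outer b b) \<le> sqrt ((cmod s)\<^sup>2 + t\<^sup>2)"
proof (rule mat_norm_Spectral_le)
  fix v :: "complex^'n"
  let ?A = "s *m outer a a + complex_of_real t *m (outer a b + outer b a) - cnj s *m outer b b"
  define p q where "p = scalar_product a v" and "q = scalar_product b v"
  \<comment> \<open>The pairing is bilinear, so \<open>p\<close> and \<open>q\<close> are
    coordinates along \<open>vec_cnj a\<close> and \<open>vec_cnj b\<close>; Bessel is applied to
    this conjugate pair.\<close>
  have "scalar_product a (vec_cnj b) = 0"
    using arg_cong[OF ab(3), of cnj] by (simp add: cnj_scalar_product)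
  then have pq: "(cmod p)\<^sup>2 + (cmod q)\<^sup>2 \<le> (norm v)\<^sup>2"
    using bessel_two[of "vec_cnj a" "vec_cnj b" v] ab by (simp add: p_def q_def)
  have "?A *v v = (s * p + t * q) *s a + (t * p - cnj s * q) *s b"
    by (simp add: matrix_vector_mult_add_rdistrib matrix_vector_mult_diff_rdistrib
        mat_scale_mult_vec outer_mult_vec p_def[symmetric] q_def[symmetric] vec_eq_iff algebra_simps)
  moreover have "scalar_product (vec_cnj (c *s a)) (d *s b) = 0" for c d
    by (simp add: ab)
  ultimately have "(norm (?A *v v))\<^sup>2 = (cmod (s * p + t * q))\<^sup>2 + (cmod (t * p - cnj s * q))\<^sup>2"
    by (simp only: norm_add_orthogonal norm_scalar_mult_vec ab mult_1_right)
  \<comment> \<open>The cross terms \<open>2 * Re (t * s * p * cnj q)\<close> cancel, as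
    \<open>t\<close> is real and the lower corner is \<open>- cnj s\<close>.\<close>
  also have "\<dots> = ((cmod s)\<^sup>2 + t\<^sup>2) * ((cmod p)\<^sup>2 + (cmod q)\<^sup>2)"
    by (simp add: cmod_power2) (simp add: power2_eq_square algebra_simps)
  also have "\<dots> \<le> ((cmod s)\<^sup>2 + t\<^sup>2) * (norm v)\<^sup>2"
    using pq by (intro mult_left_mono) auto
  finally have "norm (?A *v v) \<le> sqrt (((cmod s)\<^sup>2 + t\<^sup>2) * (norm v)\<^sup>2)"
    by (rule real_le_rsqrt)
  then show "norm (?A *v v) \<le> sqrt ((cmod s)\<^sup>2 + t\<^sup>2) * norm v"
    by (simp add: real_sqrt_mult)
qed

text \<open>Pythagoras for the part of \<open>r\<close> along \<open>vec_cnj x\<close> and the rest.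
  The rest thus vanishes exactly when \<open>cmod (scalar_product x r) = norm r\<close>.\<close>

lemma norm_projected_residual:
  assumes x: "scalar_product (vec_cnj x) x = 1"
  shows "(norm (r - scalar_product x r *s vec_cnj x))\<^sup>2 = (norm r)\<^sup>2 - (cmod (scalar_product x r))\<^sup>2"
proof -
  let ?s = "scalar_product x r" and ?a = "vec_cnj x"
  have "norm x = 1"
    using norm_eq_1_vec[OF x] by simp
  then have "norm (?s *s ?a) = cmod ?s"
    by (simp add: norm_scalar_mult_vec)
  moreover have "scalar_product (vec_cnj (?s *s ?a)) (r - ?s *s ?a) = 0"
    using x by (simp add: scalar_product_commute)
  then have "(norm (?s *s ?a + (r - ?s *s ?a)))\<^sup>2 = (norm (?s *s ?a))\<^sup>2 + (norm (r - ?s *s ?a))\<^sup>2"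
    by (rule norm_add_orthogonal)
  ultimately show ?thesis
    by simp
qed

text \<open>With \<open>t = norm w\<close>, \<open>sym_map x r\<close> is the block
  \<open>((s, t), (t, 0))\<close>. The correction fills the free corner with \<open>- cnj s\<close>,
  a norm-preserving completion in the sense of Davis, Kahan and Weinberger: the norm stays that of
  the first column, \<open>norm r\<close>.\<close>

lemma mat_norm_Spectral_extension_le:
  fixes x r :: "complex^'n"
  assumes x: "scalar_product (vec_cnj x) x = 1"
  defines "s \<equiv> scalar_product x r"
  defines "w \<equiv> r - s *s vec_cnj x"
  shows "mat_norm Spectral (sym_map x r - (if cmod s = norm r then 0
      else (cnj s / complex_of_real ((norm r)\<^sup>2 - (cmod s)\<^sup>2)) *m outer w w)) \<le> norm r"
proof -
  let ?a = "vec_cnj x"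
  \<comment> \<open>Substitute \<open>r = s *s ?a + w\<close>; the multiples of
    \<open>outer ?a ?a\<close> add up to \<open>s + s - s\<close>.\<close>
  have E: "sym_map x r = s *m outer ?a ?a + (outer ?a w + outer w ?a)"
    by (simp add: sym_map_def w_def s_def vec_eq_iff scalar_product_commute[of r x] algebra_simps)
  have w: "(norm w)\<^sup>2 = (norm r)\<^sup>2 - (cmod s)\<^sup>2"
    unfolding w_def s_def by (rule norm_projected_residual[OF x])
  have a: "norm ?a = 1"
    using norm_eq_1_vec[OF x] by simp
  show ?thesis
  proof (cases "cmod s = norm r")
    \<comment> \<open>Here \<open>r\<close> is a multiple of \<open>?a\<close>: there is no second
      direction, and the rank-one matrix already has norm \<open>cmod s = norm r\<close>.\<close>
    case True
    then have "w = 0"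
      using w by simp
    then have "sym_map x r = s *m outer ?a ?a"
      unfolding E by (simp add: vec_eq_iff)
    then show ?thesis
      using True mat_norm_le_norm[of Spectral "s *m outer ?a ?a"] a
      by (simp add: norm_mat_scale norm_outer del: mat_norm.simps)
  next
    case False
    define t where "t = norm w"
    have "(norm r)\<^sup>2 \<noteq> (cmod s)\<^sup>2"
      using False by (simp add: power2_eq_iff_nonneg)
    then have t: "t > 0"
      using w by (auto simp: t_def)
    define b where "b = complex_of_real (1 / t) *s w"
    have w_eq: "w = complex_of_real t *s b"
      using t by (simp add: b_def vec_eq_iff)
    have "norm b = 1"
      using t by (simp add: b_def norm_scalar_mult_vec t_def norm_divide)
    moreover have "scalar_product (vec_cnj ?a) b = 0"
      using x by (simp add: b_def w_def s_def
          scalar_product_commute[of x "vec_cnj x"])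
    moreover have "sym_map x r - (cnj s / complex_of_real ((norm r)\<^sup>2 - (cmod s)\<^sup>2)) *m outer w w
        = s *m outer ?a ?a + complex_of_real t *m (outer ?a b + outer b ?a) - cnj s *m outer b b"
    proof -
      \<comment> \<open>The denominator in (ii) is \<open>t\<^sup>2\<close>, which normalising both
        factors \<open>w\<close> absorbs.\<close>
      have "(cnj s / complex_of_real (t\<^sup>2)) *m outer w w = cnj s *m outer b b"
        using t by (simp add: w_eq vec_eq_iff power2_eq_square)
      moreover have "outer ?a w + outer w ?a = complex_of_real t *m (outer ?a b + outer b ?a)"
        by (simp add: w_eq vec_eq_iff algebra_simps)
      ultimately show ?thesis
        by (simp only: E t_def w)
    qed
    ultimately have "mat_norm Spectral (sym_map x r
        - (cnj s / complex_of_real ((norm r)\<^sup>2 - (cmod s)\<^sup>2)) *m outer w w) \<le> sqrt ((cmod s)\<^sup>2 + t\<^sup>2)"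
      using mat_norm_Spectral_block_le[OF a] by (simp only:)
    then show ?thesis
      using False w by (simp add: t_def del: mat_norm.simps)
  qed
qed

theorem theorem3p2:
  fixes m :: nat
    and P :: "('n::finite) matpoly"
    and l :: complex
    and x r :: "complex^'n"
    and Px :: "complex^'n^'n"
    and AF A2 :: "nat \<Rightarrow> complex^'n^'n"
  assumes "m \<ge> 1"
    and "P \<in> symmetric_matpolys m"
    and "regular_matpoly P"
    and "scalar_product (vec_cnj x) x = 1"
    and r_def: "r = - (mpeval P l *v x)"
    and Px_def: "Px = mat 1 - outer x (vec_cnj x)"
    and AF_def: "\<And>j. AF j =
        (cnj (l ^ j) / complex_of_real ((Lambda_norm m l)\<^sup>2)) *m
          (outer (vec_cnj x) r + outer r (vec_cnj x)
            - scalar_product r x *m outer (vec_cnj x) (vec_cnj x))"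
    and A2_def: "\<And>j. A2 j =
        (cnj (l ^ j) / complex_of_real ((Lambda_norm m l)\<^sup>2)) *m
          (outer (vec_cnj x) r + outer r (vec_cnj x)
            - scalar_product r x *m outer (vec_cnj x) (vec_cnj x))
        - (if cmod (scalar_product x r) = norm r then 0
           else (cnj (l ^ j) * cnj (scalar_product x r) /
                 complex_of_real ((Lambda_norm m l)\<^sup>2
                   * ((norm r)\<^sup>2 - (cmod (scalar_product x r))\<^sup>2))) *m
                (transpose Px ** outer r r ** Px))"
  shows "sym_backward_error Frobenius m l x P
           = sqrt (2 * (norm r)\<^sup>2 - (cmod (scalar_product x r))\<^sup>2) / Lambda_norm m l
    \<and> (\<forall>M. sym_backward_error Frobenius m l x P \<le> sqrt 2 * backward_error M m l x P)
    \<and> (\<forall>M. sym_backward_error Spectral m l x P = backward_error M m l x P)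
    \<and> (\<forall>D. (D \<in> symmetric_matpolys m
              \<and> mpeval P l *v x + mpeval D l *v x = 0
              \<and> mp_norm Frobenius m D = sym_backward_error Frobenius m l x P)
            \<longleftrightarrow> D = mpoly_of m AF)
    \<and> mpoly_of m A2 \<in> symmetric_matpolys m
    \<and> mpeval P l *v x + mpeval (mpoly_of m A2) l *v x = 0
    \<and> mp_norm Spectral m (mpoly_of m A2) = sym_backward_error Spectral m l x P"
proof -
  let ?L = "Lambda_norm m l" and ?a = "vec_cnj x" and ?s = "scalar_product x r"
  let ?E = "sym_map x r"
  let ?bF = "sqrt (2 * (norm r)\<^sup>2 - (cmod ?s)\<^sup>2) / ?L"
  have x: "scalar_product ?a x = 1"
    using assms(4) .
  have nx: "norm x = 1"
    using norm_eq_1_vec[OF x] by simp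
  have L: "?L > 0"
    by (rule Lambda_norm_pos)
  have constraint: "mpeval P l *v x + mpeval D l *v x = 0 \<longleftrightarrow> mpeval D l *v x = r" for D :: "'n matpoly"
    unfolding r_def by (simp add: add_eq_0_iff)
  have symD: "D \<in> matpolys m" "transpose (mpeval D l) = mpeval D l"
    if "D \<in> symmetric_matpolys m" for D :: "'n matpoly"
    using that by (auto simp: symmetric_matpolys_def)
  have lower: "norm r / ?L \<le> mp_norm M m D"
    if "D \<in> matpolys m" "mpeval D l *v x = r" for M and D :: "'n matpoly"
    using mp_norm_lower_bound[OF that(1) nx, of l M] that(2) by simp

  have AF: "AF = spread m l ?E"
    by (rule ext) (simp only: AF_def spread_def sym_map_def)
  have AF_sym: "mpoly_of m AF \<in> symmetric_matpolys m"
    unfolding AF by (intro spread_symmetric transpose_sym_map)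
  have AF_x: "mpeval (mpoly_of m AF) l *v x = r"
    unfolding AF mpeval_spread by (rule sym_map_mult_unit[OF x])
  have AF_norm: "mp_norm Frobenius m (mpoly_of m AF) = ?bF"
    unfolding AF mp_norm_spread by (simp flip: norm_sym_map_square[OF x])
  \<comment> \<open>The difference \<open>mpeval D l - ?E\<close> is symmetric and annihilates
    \<open>x\<close>, hence is orthogonal to \<open>?E\<close>.\<close>
  have pyth: "(mp_norm Frobenius m D)\<^sup>2 = ?bF\<^sup>2 + (\<Sum>j\<le>m. (norm (coeff D j - AF j))\<^sup>2)"
    if D: "D \<in> symmetric_matpolys m" "mpeval D l *v x = r" for D :: "'n matpoly"
  proof -
    have "inner (mpeval D l - ?E) ?E = 0"
      using D symD[OF D(1)] by (intro inner_sym_map_eq_0)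
        (simp_all add: transpose_diff transpose_sym_map matrix_vector_mult_diff_rdistrib
          sym_map_mult_unit[OF x])
    from mp_norm_Frobenius_pythagoras[OF symD(1)[OF D(1)] this] show ?thesis
      by (simp only: AF_norm flip: AF)
  qed
  have mp_nonneg: "0 \<le> mp_norm M m D" for M and D :: "'n matpoly"
    by (simp add: mp_norm_def sum_nonneg)
  have symF: "sym_backward_error Frobenius m l x P = ?bF"
    unfolding sym_backward_error_def
  proof (rule backward_error_on_eqI[OF AF_sym _ AF_norm], unfold constraint)
    show "?bF \<le> mp_norm Frobenius m D"
      if "D \<in> symmetric_matpolys m" "mpeval D l *v x = r" for D
      using pyth[OF that] mp_nonneg
      by (intro power2_le_imp_le[of ?bF]) (simp_all add: sum_nonneg)
  qed (rule AF_x)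

  have unstr: "backward_error M m l x P = norm r / ?L" for M
    unfolding backward_error_def
  proof (rule backward_error_on_eqI, unfold constraint)
    \<comment> \<open>The rank-one matrix \<open>r x^H\<close> sends \<open>x\<close> to
      \<open>r\<close> and has norm at most \<open>norm r\<close> in both norms, so it meets the
      lower bound.\<close>
    let ?D = "mpoly_of m (spread m l (outer r ?a))"
    show D: "?D \<in> matpolys m"
      by (rule mpoly_of_in_matpolys)
    show Dx: "mpeval ?D l *v x = r"
      by (simp add: mpeval_spread outer_mult_vec x)
    have "mat_norm M (outer r ?a) \<le> norm r"
      using mat_norm_le_norm[of M "outer r ?a"] nx by (simp add: norm_outer)
    then have "mp_norm M m ?D \<le> norm r / ?L"
      unfolding mp_norm_spread using L by (simp add: divide_right_mono)
    with lower[OF D Dx] show "mp_norm M m ?D = norm r / ?L"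
      by (rule antisym[rotated])
  qed (rule lower)

  define w where "w = r - ?s *s ?a"
  define G where "G = ?E - (if cmod ?s = norm r then 0
      else (cnj ?s / complex_of_real ((norm r)\<^sup>2 - (cmod ?s)\<^sup>2)) *m outer w w)"
  have "transpose Px *v r = w"
    by (simp add: Px_def transpose_diff matrix_vector_mult_diff_rdistrib outer_mult_vec w_def)
  then have "transpose Px ** outer r r ** Px = outer w w"
    by (simp add: mult_outer_mult)
  \<comment> \<open>Both terms of \<open>A2 j\<close> share the weight of \<open>spread\<close>, so
    they combine into the single matrix \<open>G\<close>.\<close>
  then have A2: "A2 = spread m l G"
    by (intro ext) (simp add: A2_def spread_def G_def sym_map_def mat_scale_diff mat_scale_mat_scale)
  have A2_sym: "mpoly_of m A2 \<in> symmetric_matpolys m"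
    unfolding A2 by (intro spread_symmetric)
      (simp add: G_def transpose_diff transpose_sym_map transpose_mat_scale)
  \<comment> \<open>The correction \<open>outer w w\<close> therefore annihilates \<open>x\<close>
    and leaves the constraint intact.\<close>
  have "scalar_product w x = 0"
    by (simp add: w_def x scalar_product_commute[of r x])
  then have A2_x: "mpeval (mpoly_of m A2) l *v x = r"
    unfolding A2 mpeval_spread G_def
    by (simp add: matrix_vector_mult_diff_rdistrib sym_map_mult_unit[OF x] mat_scale_mult_vec
        outer_mult_vec)
  have "mat_norm Spectral G \<le> norm r"
    unfolding G_def w_def by (rule mat_norm_Spectral_extension_le[OF x])
  then have "mp_norm Spectral m (mpoly_of m A2) \<le> norm r / ?L"
    unfolding A2 mp_norm_spread using L by (intro divide_right_mono) auto
  with lower[OF mpoly_of_in_matpolys A2_x] have A2_norm: "mp_norm Spectral m (mpoly_of m A2) = norm r / ?L"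
    by (rule antisym[rotated])
  \<comment> \<open>The unstructured lower bound is attained by a symmetric polynomial, so symmetry
    costs nothing in the spectral norm.\<close>
  have sym2: "sym_backward_error Spectral m l x P = norm r / ?L"
    unfolding sym_backward_error_def
    by (rule backward_error_on_eqI[OF A2_sym _ A2_norm], unfold constraint)
      (use A2_x lower symD(1) in blast)+

  have "sqrt (2 * (norm r)\<^sup>2 - (cmod ?s)\<^sup>2) \<le> sqrt (2 * (norm r)\<^sup>2)"
    by simp
  then have F_le: "?bF \<le> sqrt 2 * (norm r / ?L)"
    using L by (simp add: real_sqrt_mult divide_right_mono)
  have unique: "D = mpoly_of m AF"
    if D: "D \<in> symmetric_matpolys m" "mpeval D l *v x = r" "mp_norm Frobenius m D = ?bF" for D
  proof (rule poly_eqI)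
    fix j
    have "(\<Sum>j\<le>m. (norm (coeff D j - AF j))\<^sup>2) = 0"
      using pyth[OF D(1,2)] D(3) by simp
    then have "\<forall>j\<le>m. coeff D j = AF j"
      by (subst (asm) sum_nonneg_eq_0_iff) auto
    \<comment> \<open>For \<open>j > m\<close> both coefficients vanish by the degree bound.\<close>
    then show "coeff D j = coeff (mpoly_of m AF) j"
      using symD(1)[OF D(1)] by (auto simp: coeff_mpoly_of matpolys_def coeff_eq_0)
  qed
  show ?thesis
    unfolding constraint symF sym2 unstr
    using F_le unique AF_sym AF_x AF_norm A2_sym A2_x A2_norm by blast
qed

end
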